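(* Let $k$ and $m$ be positive integers with $k$ odd. If a finite simple graph $G$ is $(2mk:mk)$-choosable, then $G$ is also $2m$-choosable (i.e., $(2m:1)$-choosable).
   Context: A graph $G=(V,E)$ is $(a:b)$-choosable if for every family of sets $\{S(v):v\in V\}$ with $|S(v)|=a$ for all $v$, there exist subsets $C(v)\subseteq S(v)$ with $|C(v)|=b$ for every $v$ and $C(u)\cap C(v)=\emptyset$ whenever $u,v$ are adjacent. $k$-choosable means $(k:1)$-choosable. *)

theory Defs
  imports "Graph_Theory.Digraph"
begin

(* Colours are natural numbers; choosable_any_colours shows that, for finite vertex sets,
   this covers families of sets over an arbitrary colour type.  Finiteness of S v is explicit
   because card of an infinite set is 0.  Used for G with "graph G", whose arc relation is
   symmetric, irreflexive and without multiple arcs, i.e. a finite simple graph. *)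
definition ab_choosable :: "('a, 'b) pre_digraph \<Rightarrow> nat \<Rightarrow> nat \<Rightarrow> bool" where
  "ab_choosable G a b \<longleftrightarrow>
    (\<forall>S :: 'a \<Rightarrow> nat set. (\<forall>v \<in> verts G. finite (S v) \<and> card (S v) = a) \<longrightarrow>
      (\<exists>C :: 'a \<Rightarrow> nat set.
        (\<forall>v \<in> verts G. C v \<subseteq> S v \<and> card (C v) = b) \<and>
        (\<forall>u \<in> verts G. \<forall>v \<in> verts G. u \<rightarrow>\<^bsub>G\<^esub> v \<longrightarrow> C u \<inter> C v = {})))"

definition choosable :: "('a, 'b) pre_digraph \<Rightarrow> nat \<Rightarrow> bool" where
  "choosable G k \<longleftrightarrow> ab_choosable G k 1"

lemma choosable_any_colours:
  fixes S :: "'a \<Rightarrow> 'c set"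
  assumes ch: "ab_choosable G a b" and fin: "finite (verts G)"
    and S: "\<And>v. v \<in> verts G \<Longrightarrow> finite (S v) \<and> card (S v) = a"
  shows "\<exists>C. (\<forall>v \<in> verts G. C v \<subseteq> S v \<and> card (C v) = b) \<and>
    (\<forall>u \<in> verts G. \<forall>v \<in> verts G. u \<rightarrow>\<^bsub>G\<^esub> v \<longrightarrow> C u \<inter> C v = {})"
proof -
  define U where "U = (\<Union>v \<in> verts G. S v)"
  have "finite U" unfolding U_def using fin S by (intro finite_UN_I) simp_all
  then obtain f :: "'c \<Rightarrow> nat" where f: "inj_on f U"
    using finite_imp_inj_to_nat_seg[OF \<open>finite U\<close>] by (elim exE conjE)
  have inj: "inj_on f (S v)" if "v \<in> verts G" for v
    by (rule inj_on_subset[OF f]) (use that in \<open>auto simp: U_def\<close>)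
  have "\<forall>v \<in> verts G. finite (f ` S v) \<and> card (f ` S v) = a"
    using S card_image[OF inj] by simp
  with ch have "\<exists>D. (\<forall>v \<in> verts G. D v \<subseteq> f ` S v \<and> card (D v) = b) \<and>
      (\<forall>u \<in> verts G. \<forall>v \<in> verts G. u \<rightarrow>\<^bsub>G\<^esub> v \<longrightarrow> D u \<inter> D v = {})"
    unfolding ab_choosable_def by (elim allE[of _ "\<lambda>v. f ` S v"] impE)
  then obtain D where D0: "\<forall>v \<in> verts G. D v \<subseteq> f ` S v \<and> card (D v) = b"
    and disj0: "\<forall>u \<in> verts G. \<forall>v \<in> verts G. u \<rightarrow>\<^bsub>G\<^esub> v \<longrightarrow> D u \<inter> D v = {}"
    by (elim exE conjE)
  note D = D0[rule_format] and disj = disj0[rule_format]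
  define C where "C = (\<lambda>v. S v \<inter> f -` D v)"
  have sub: "C v \<subseteq> S v" for v
    by (auto simp: C_def)
  have card: "card (C v) = b" if "v \<in> verts G" for v
  proof -
    have "D v \<subseteq> f ` S v" using D[OF that] ..
    then have "f ` C v = D v" unfolding C_def by blast
    then show ?thesis
      using D[OF that] card_image[OF inj_on_subset[OF inj[OF that] sub]] by simp
  qed
  have disjC: "C u \<inter> C v = {}"
    if "u \<in> verts G" "v \<in> verts G" "u \<rightarrow>\<^bsub>G\<^esub> v" for u v
    using disj[OF that] unfolding C_def by blast
  show ?thesis
    by (rule exI[of _ C]) (intro conjI ballI impI sub card disjC)
qed

end

theory Submission
  imports Defs
begin

text \<open>Replace every colour by \<open>k\<close> copies of itself. A \<open>(2mk:mk)\<close>-choice gives each vertex half of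
  the copies of its \<open>2m\<close> colours, so some colour occurs there with at least \<open>k/2\<close> copies and, \<open>k\<close>
  being odd, with more than \<open>k/2\<close>. Adjacent vertices receive disjoint sets of copies, hence cannot
  both own a majority of the copies of the same colour.\<close>

lemma exists_majority_fibre:
  fixes A :: "'c set" and D :: "('c \<times> nat) set"
  assumes "finite A" and card_A: "card A = 2 * m" and sub: "D \<subseteq> A \<times> {..<k}"
    and card_D: "card D = m * k" and "m > 0" and "odd k"
  shows "\<exists>c \<in> A. k < 2 * card (D `` {c})"
proof (rule ccontr)
  assume none: "\<not> ?thesis"
  \<comment> \<open>Parity enters here: twice a fibre size is even, so it cannot equal the odd
    number \<open>k\<close>. Excluding equality rules out the balanced case in which every fibre has
    exactly half of the copies.\<close>
  have le: "2 * card (D `` {c}) \<le> k - 1" if "c \<in> A" for c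
  proof -
    have "2 * card (D `` {c}) \<le> k" using none that by auto
    moreover have "2 * card (D `` {c}) \<noteq> k" using \<open>odd k\<close> by (metis dvd_triv_left)
    ultimately show ?thesis by linarith
  qed
  have fin: "finite (D `` {c})" for c
    by (rule finite_subset[of _ "{..<k}"]) (use sub in auto)
  \<comment> \<open>\<open>D\<close> splits into its fibres over the colours in \<open>A\<close>, so
    its size is the sum of theirs.\<close>
  have "D = Sigma A (\<lambda>c. D `` {c})" using sub by auto
  then have "card D = (\<Sum>c\<in>A. card (D `` {c}))"
    using card_SigmaI[of A "\<lambda>c. D `` {c}"] \<open>finite A\<close> fin by simp
  then have "2 * (m * k) = (\<Sum>c\<in>A. 2 * card (D `` {c}))"
    by (simp add: card_D sum_distrib_left)
  also have "\<dots> \<le> 2 * m * (k - 1)"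
    using sum_bounded_above[of A "\<lambda>c. 2 * card (D `` {c})" "k - 1"] le card_A by simp
  \<comment> \<open>Natural subtraction truncates, so strictness needs \<open>k\<close> positive,
    which oddness supplies.\<close>
  also have "\<dots> < 2 * m * k"
    using \<open>m > 0\<close> odd_pos[OF \<open>odd k\<close>] by simp
  finally show False by simp
qed

theorem theorem5:
  fixes G :: "('a, 'b) pre_digraph" and k m :: nat
  assumes "Digraph.graph G"
    and "k > 0" and "m > 0" and "odd k"
    and "ab_choosable G (2 * m * k) (m * k)"
  shows "choosable G (2 * m)"
  unfolding choosable_def ab_choosable_def
proof (intro allI impI)
  fix S :: "'a \<Rightarrow> nat set"
  assume S: "\<forall>v \<in> verts G. finite (S v) \<and> card (S v) = 2 * m"
  interpret Digraph.graph G by fact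
  have "\<exists>D. (\<forall>v \<in> verts G. D v \<subseteq> S v \<times> {..<k} \<and> card (D v) = m * k) \<and>
      (\<forall>u \<in> verts G. \<forall>v \<in> verts G. u \<rightarrow>\<^bsub>G\<^esub> v \<longrightarrow> D u \<inter> D v = {})"
    \<comment> \<open>The copies are pairs, not natural numbers, so the version for arbitrary colour
      types is applied, to the lists \<open>S v \<times> {..<k}\<close>.\<close>
    by (rule choosable_any_colours[OF assms(5)]) (use S in \<open>auto simp: card_cartesian_product\<close>)
  then obtain D where D: "\<And>v. v \<in> verts G \<Longrightarrow> D v \<subseteq> S v \<times> {..<k}"
    and card_D: "\<And>v. v \<in> verts G \<Longrightarrow> card (D v) = m * k"
    and disj: "\<And>u v. u \<in> verts G \<Longrightarrow> v \<in> verts G \<Longrightarrow> u \<rightarrow>\<^bsub>G\<^esub> v \<Longrightarrow> D u \<inter> D v = {}"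
    by metis
  have "\<forall>v \<in> verts G. \<exists>c \<in> S v. k < 2 * card (D v `` {c})"
    using exists_majority_fibre[OF _ _ D card_D \<open>m > 0\<close> \<open>odd k\<close>] S by simp
  then obtain c where c: "\<And>v. v \<in> verts G \<Longrightarrow> c v \<in> S v"
    and majority: "\<And>v. v \<in> verts G \<Longrightarrow> k < 2 * card (D v `` {c v})"
    by metis
  have "c u \<noteq> c v" if "u \<in> verts G" "v \<in> verts G" "u \<rightarrow>\<^bsub>G\<^esub> v" for u v
  proof
    assume eq: "c u = c v"
    \<comment> \<open>Over a common colour both fibres consist of indices below \<open>k\<close>,
      and they inherit disjointness from \<open>D u\<close> and \<open>D v\<close>. Two majorities
      would together need more than \<open>k\<close> indices.\<close>
    let ?U = "D u `` {c v}" and ?V = "D v `` {c v}"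
    have sub: "?U \<subseteq> {..<k}" "?V \<subseteq> {..<k}" using D that by auto
    have "?U \<inter> ?V = {}" using disj[OF that] by auto
    then have "card ?U + card ?V = card (?U \<union> ?V)"
      using sub by (simp add: card_Un_disjoint finite_subset)
    also have "\<dots> \<le> k"
      using card_mono[of "{..<k}" "?U \<union> ?V"] sub by simp
    finally show False
      using majority[OF that(1)] majority[OF that(2)] eq by simp
  qed
  then show "\<exists>C. (\<forall>v \<in> verts G. C v \<subseteq> S v \<and> card (C v) = 1) \<and>
      (\<forall>u \<in> verts G. \<forall>v \<in> verts G. u \<rightarrow>\<^bsub>G\<^esub> v \<longrightarrow> C u \<inter> C v = {})"
    using c by (intro exI[of _ "\<lambda>v. {c v}"]) auto
qed

end
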